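(* A set of vertices $U$ in a connected graph $G$ is contained in a normal tree of $G$ (that is, there is a rooted tree $T \subseteq G$ that is normal in $G$ with $U \subseteq V(T)$) provided every fat $TK^{\aleph_0}$ in $G$ can be separated from $U$ by a finite set of vertices.
   Context: Graphs may be infinite of any cardinality. A fat $TK^{\aleph_0}$ is any subdivision of the multigraph obtained from the countably infinite complete graph $K^{\aleph_0}$ by replacing every edge with $\aleph_1$ parallel edges; a fat $TK^{\aleph_0}$ in $G$ is a subgraph of $G$ of this form. A set $X \subseteq V(G)$ separates a subgraph $H \subseteq G$ from a set $U \subseteq V(G)$ if every path in $G$ (possibly trivial) between a vertex of $U$ and a vertex of $H$ meets $X$. For a tree $T$ with root $r$, the tree order $\leq_T$ on $V(T)$ is defined by $u \leq_T v$ if $u$ lies on the unique path in $T$ from $r$ to $v$. For $T \subseteq G$, a $T$-path in $G$ is a path in $G$ with end vertices in $T$ but all edges and inner vertices outside of $T$. A rooted tree $T \subseteq G$ (not necessarily spanning) is normal in $G$ if the end vertices of any $T$-path in $G$ are comparable in $\leq_T$. *)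

theory Defs
  imports Main
begin

record 'a ugraph =
  verts :: "'a set"
  edges :: "'a set set"

definition graph :: "'a ugraph \<Rightarrow> bool" where
  "graph G \<longleftrightarrow> (\<forall>e\<in>edges G. e \<subseteq> verts G \<and> card e = 2)"

definition subgraph :: "'a ugraph \<Rightarrow> 'a ugraph \<Rightarrow> bool" where
  "subgraph H G \<longleftrightarrow> graph H \<and> verts H \<subseteq> verts G \<and> edges H \<subseteq> edges G"

definition path_edges :: "'a list \<Rightarrow> 'a set set" where
  "path_edges p = {{p ! i, p ! Suc i} | i. Suc i < length p}"

definition inner_verts :: "'a list \<Rightarrow> 'a set" where
  "inner_verts p = set (butlast (tl p))"

text \<open>A path is given by its sequence of vertices; one-vertex (trivial) paths are allowed.\<close>

definition is_path :: "'a ugraph \<Rightarrow> 'a list \<Rightarrow> bool" where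
  "is_path G p \<longleftrightarrow>
     p \<noteq> [] \<and> distinct p \<and> set p \<subseteq> verts G \<and> path_edges p \<subseteq> edges G"

definition path_between :: "'a ugraph \<Rightarrow> 'a \<Rightarrow> 'a list \<Rightarrow> 'a \<Rightarrow> bool" where
  "path_between G u p v \<longleftrightarrow> is_path G p \<and> hd p = u \<and> last p = v"

definition connected_graph :: "'a ugraph \<Rightarrow> bool" where
  "connected_graph G \<longleftrightarrow>
     verts G \<noteq> {} \<and> (\<forall>u\<in>verts G. \<forall>v\<in>verts G. \<exists>p. path_between G u p v)"

definition is_cycle :: "'a ugraph \<Rightarrow> 'a list \<Rightarrow> bool" where
  "is_cycle G c \<longleftrightarrow> is_path G c \<and> length c \<ge> 3 \<and> {last c, hd c} \<in> edges G"

definition tree :: "'a ugraph \<Rightarrow> bool" where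
  "tree T \<longleftrightarrow> graph T \<and> connected_graph T \<and> (\<nexists>c. is_cycle T c)"

text \<open>
  For a tree \<open>T\<close> and vertices \<open>r\<close>, \<open>v\<close> of \<open>T\<close> the path \<open>p\<close> below exists and is unique.
\<close>

definition tree_le :: "'a ugraph \<Rightarrow> 'a \<Rightarrow> 'a \<Rightarrow> 'a \<Rightarrow> bool" where
  "tree_le T r u v \<longleftrightarrow> (\<exists>p. path_between T r p v \<and> u \<in> set p)"

definition T_path :: "'a ugraph \<Rightarrow> 'a ugraph \<Rightarrow> 'a list \<Rightarrow> bool" where
  "T_path G T p \<longleftrightarrow>
     is_path G p \<and> hd p \<in> verts T \<and> last p \<in> verts T \<and>
     inner_verts p \<inter> verts T = {} \<and> path_edges p \<inter> edges T = {}"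

definition normal_tree :: "'a ugraph \<Rightarrow> 'a ugraph \<Rightarrow> 'a \<Rightarrow> bool" where
  "normal_tree G T r \<longleftrightarrow>
     subgraph T G \<and> tree T \<and> r \<in> verts T \<and>
     (\<forall>p. T_path G T p \<longrightarrow> tree_le T r (hd p) (last p) \<or> tree_le T r (last p) (hd p))"

text \<open>
  \<open>mends\<close> maps an edge of a loopless multigraph to the two-element set of its end vertices.
\<close>

record ('v, 'e) multigraph =
  mverts :: "'v set"
  medges :: "'e set"
  mends :: "'e \<Rightarrow> 'v set"

text \<open>
  \<open>H\<close> arises from the loopless multigraph \<open>M\<close> by replacing the edges \<open>e\<close> of \<open>M\<close> with
  independent paths \<open>P e\<close> between the images under \<open>b\<close> of the ends of \<open>e\<close>. Disjointness of
  the edge sets has to be demanded separately: otherwise several parallel edges could be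
  represented by one and the same edge of the simple graph \<open>H\<close>.
\<close>

definition subdivision_of :: "('v, 'e) multigraph \<Rightarrow> 'a ugraph \<Rightarrow> bool" where
  "subdivision_of M H \<longleftrightarrow> (\<exists>b P.
     inj_on b (mverts M) \<and>
     (\<forall>e\<in>medges M. is_path H (P e) \<and> {hd (P e), last (P e)} = b ` mends M e \<and>
        inner_verts (P e) \<inter> b ` mverts M = {}) \<and>
     (\<forall>e\<in>medges M. \<forall>f\<in>medges M. e \<noteq> f \<longrightarrow>
        inner_verts (P e) \<inter> inner_verts (P f) = {} \<and>
        path_edges (P e) \<inter> path_edges (P f) = {}) \<and>
     verts H = b ` mverts M \<union> (\<Union>e\<in>medges M. set (P e)) \<and>
     edges H = (\<Union>e\<in>medges M. path_edges (P e)))"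

text \<open>
  The countably infinite complete graph on \<open>nat\<close> with every edge replaced by \<open>\<aleph>\<^sub>1\<close> parallel
  edges. These are indexed by the field of \<open>cardSuc natLeq\<close>, the successor cardinal of \<open>\<aleph>\<^sub>0\<close>.
\<close>

definition fat_K :: "(nat, nat set \<times> nat set) multigraph" where
  "fat_K = \<lparr> mverts = UNIV,
             medges = {{i, j} | i j. i \<noteq> j} \<times> Field (cardSuc natLeq),
             mends = fst \<rparr>"

lemma card_of_parallel_edges_fat_K:
  includes cardinal_syntax
  assumes "i \<noteq> j"
  shows "|{e \<in> medges fat_K. mends fat_K e = {i, j}}| =o cardSuc natLeq"
proof -
  have "{i, j} \<in> {{k, l} | k l. k \<noteq> l}"
    using assms by blast
  then have eq: "{e \<in> medges fat_K. mends fat_K e = {i, j}} = {{i, j}} \<times> Field (cardSuc natLeq)"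
    unfolding fat_K_def by fastforce
  have "|{{i, j}} \<times> Field (cardSuc natLeq)| =o |Field (cardSuc natLeq)|"
    unfolding card_of_ordIso[symmetric]
    by (intro exI[of _ snd]) (simp add: bij_betw_def inj_on_def)
  moreover have "|Field (cardSuc natLeq)| =o cardSuc natLeq"
    by (rule card_of_Field_ordIso[OF cardSuc_Card_order[OF natLeq_Card_order]])
  ultimately show ?thesis
    unfolding eq by (rule ordIso_transitive)
qed

definition fat_TK_in :: "'a ugraph \<Rightarrow> 'a ugraph \<Rightarrow> bool" where
  "fat_TK_in G H \<longleftrightarrow> subgraph H G \<and> subdivision_of fat_K H"

definition separates :: "'a ugraph \<Rightarrow> 'a set \<Rightarrow> 'a ugraph \<Rightarrow> 'a set \<Rightarrow> bool" where
  "separates G X H U \<longleftrightarrow> X \<subseteq> verts G \<and>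
     (\<forall>p. is_path G p \<and> hd p \<in> U \<and> last p \<in> verts H \<longrightarrow> set p \<inter> X \<noteq> {})"

end

theory Submission
  imports Defs "HOL-Library.Countable_Set_Type"
begin

text \<open>
  Any depth-first search, in which the current branch \<open>c\<close> is extended into each component of
  \<open>G - c\<close> by a neighbour of its last vertex, produces a normal tree, and a vertex \<open>u\<close> is missed
  only if its components \<open>D\<^sub>n\<close> decrease along an infinite ray \<open>s\<^sub>0, s\<^sub>1, \<dots>\<close>. The search is
  steered by countably many targets: for any two vertices \<open>x, y\<close> on the branch, all vertices of
  a fixed maximal family of independent \<open>x\<close>-\<open>y\<close> paths, if this family is countable; and
  again and again some vertex of \<open>U\<close> in the current component. If \<open>u \<in> U\<close> is missed, then its
  component after deletion of the whole ray has infinitely many neighbours \<open>s\<^sub>k\<close>, and a path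
  through this component avoids every target; so by maximality any two of these neighbours are
  joined by uncountably many independent paths, and they are the branch vertices of a fat
  subdivided clique. It is not separated from \<open>U\<close> by a finite set, since infinitely many of the
  disjoint sets \<open>D\<^sub>n - D\<^sub>n\<^sub>+\<^sub>1\<close> contain a path from \<open>s\<^sub>n\<^sub>+\<^sub>1\<close> to \<open>U\<close>.
\<close>

section \<open>Paths and connectedness inside a vertex set\<close>

lemma path_edges_subset_iff:
  "path_edges p \<subseteq> E \<longleftrightarrow> successively (\<lambda>x y. {x, y} \<in> E) p"
  unfolding path_edges_def successively_conv_nth by blast

lemma is_path_iff:
  "is_path G p \<longleftrightarrow> p \<noteq> [] \<and> distinct p \<and> set p \<subseteq> verts G \<and>
     successively (\<lambda>x y. {x, y} \<in> edges G) p"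
  by (simp add: is_path_def path_edges_subset_iff)

lemma inner_verts_subset: "inner_verts p \<subseteq> set p"
  unfolding inner_verts_def by (cases p) (auto dest: in_set_butlastD)

lemma set_path_eq_inner_verts:
  assumes "p \<noteq> []"
  shows "set p = insert (hd p) (insert (last p) (inner_verts p))"
proof (cases p)
  case (Cons a q)
  then show ?thesis
    by (cases q rule: rev_cases) (auto simp: inner_verts_def)
qed (use assms in auto)

text \<open>Edge-disjointness of subdivided edges rests on this: with an inner vertex present, no
  edge of the path joins its two ends, so paths whose inner vertices lie on no other path share no
  edge.\<close>

lemma path_edge_meets_inner_verts:
  assumes "e \<in> path_edges p" "inner_verts p \<noteq> {}"
  shows "e \<subseteq> set p \<and> e \<inter> inner_verts p \<noteq> {}"
proof -
  obtain i where i: "e = {p ! i, p ! Suc i}" "Suc i < length p"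
    using assms(1) unfolding path_edges_def by auto
  obtain a q b where p: "p = a # q @ [b]" "q \<noteq> []"
  proof (cases p)
    case (Cons a q)
    then show ?thesis
      using assms(2) that by (cases q rule: rev_cases) (auto simp: inner_verts_def)
  qed (use assms(2) in \<open>simp add: inner_verts_def\<close>)
  have inner: "inner_verts p = set q"
    by (simp add: p inner_verts_def)
  have "p ! i \<in> set q \<or> p ! Suc i \<in> set q"
  proof (cases i)
    case 0
    then show ?thesis
      using p by (auto simp: nth_append)
  next
    case (Suc j)
    then show ?thesis
      using p i(2) by (auto simp: nth_append)
  qed
  moreover have "p ! i \<in> set p" "p ! Suc i \<in> set p"
    using i(2) by auto
  ultimately show ?thesis
    using i(1) inner by auto
qed

lemma is_path_append_left: "is_path G (p @ q) \<Longrightarrow> p \<noteq> [] \<Longrightarrow> is_path G p"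
  by (auto simp: is_path_iff successively_append_iff)

lemma is_path_append_right: "is_path G (p @ q) \<Longrightarrow> q \<noteq> [] \<Longrightarrow> is_path G q"
  by (auto simp: is_path_iff successively_append_iff)

lemma is_path_Cons:
  "is_path G (x # p) \<longleftrightarrow> x \<in> verts G \<and> x \<notin> set p \<and> (p = [] \<or> is_path G p \<and> {x, hd p} \<in> edges G)"
  by (auto simp: is_path_iff successively_Cons)

lemma is_path_rev: "is_path G (rev p) \<longleftrightarrow> is_path G p"
  by (simp add: is_path_iff insert_commute)

definition conn :: "'a ugraph \<Rightarrow> 'a set \<Rightarrow> 'a \<Rightarrow> 'a \<Rightarrow> bool" where
  "conn G S x y \<longleftrightarrow> (\<exists>p. path_between G x p y \<and> set p \<subseteq> S)"

lemma connE:
  assumes "conn G S x y"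
  obtains p where "is_path G p" "hd p = x" "last p = y" "set p \<subseteq> S"
  using assms unfolding conn_def path_between_def by blast

lemma connI: "is_path G p \<Longrightarrow> hd p = x \<Longrightarrow> last p = y \<Longrightarrow> set p \<subseteq> S \<Longrightarrow> conn G S x y"
  unfolding conn_def path_between_def by blast

lemma conn_refl: "x \<in> verts G \<Longrightarrow> x \<in> S \<Longrightarrow> conn G S x x"
  by (rule connI[of _ "[x]"]) (auto simp: is_path_iff)

lemma conn_sym:
  assumes "conn G S x y"
  shows "conn G S y x"
proof -
  obtain p where "is_path G p" "hd p = x" "last p = y" "set p \<subseteq> S"
    using assms by (rule connE)
  then show ?thesis
    by (intro connI[of G "rev p"]) (simp_all add: is_path_rev hd_rev last_rev)
qed

lemma conn_mono: "conn G S x y \<Longrightarrow> S \<subseteq> S' \<Longrightarrow> conn G S' x y"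
  unfolding conn_def by blast

lemma conn_in:
  assumes "conn G S x y"
  shows "x \<in> S" "y \<in> S" "x \<in> verts G" "y \<in> verts G"
proof -
  obtain p where "is_path G p" "hd p = x" "last p = y" "set p \<subseteq> S"
    using assms by (rule connE)
  moreover from this have "x \<in> set p" "y \<in> set p"
    by (auto simp: is_path_iff)
  ultimately show "x \<in> S" "y \<in> S" "x \<in> verts G" "y \<in> verts G"
    by (auto simp: is_path_iff)
qed

text \<open>\<open>conn\<close> is witnessed by paths, not walks, so prepending \<open>x\<close> may
  repeat a vertex; then only the part of the path from \<open>x\<close> onwards is kept.\<close>

lemma conn_edge_trans:
  assumes "{x, y} \<in> edges G" "x \<in> verts G" "x \<in> S" "conn G S y z"
  shows "conn G S x z"
proof -
  obtain p where p: "is_path G p" "hd p = y" "last p = z" "set p \<subseteq> S"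
    using assms(4) by (rule connE)
  show ?thesis
  proof (cases "x \<in> set p")
    case True
    then obtain q q' where "p = q @ x # q'"
      by (meson split_list)
    then show ?thesis
      using p by (intro connI[of _ "x # q'"]) (auto dest: is_path_append_right)
  next
    case False
    have "p \<noteq> []"
      using p(1) by (simp add: is_path_iff)
    then show ?thesis
      using False assms p by (intro connI[of _ "x # p"]) (auto simp: is_path_Cons)
  qed
qed

lemma conn_trans:
  assumes "conn G S x y" "conn G S y z"
  shows "conn G S x z"
proof -
  have "is_path G p \<Longrightarrow> set p \<subseteq> S \<Longrightarrow> last p = y \<Longrightarrow> conn G S (hd p) z" for p
  proof (induction p)
    case (Cons a p)
    show ?case
    proof (cases "p = []")
      case False
      then show ?thesis
        using Cons by (auto simp: is_path_Cons intro: conn_edge_trans)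
    qed (use Cons assms(2) in auto)
  qed (simp add: is_path_iff)
  then show ?thesis
    using assms(1) by (auto elim: connE)
qed

lemma conn_edge:
  "{x, y} \<in> edges G \<Longrightarrow> x \<in> verts G \<Longrightarrow> y \<in> verts G \<Longrightarrow> x \<in> S \<Longrightarrow> y \<in> S \<Longrightarrow> conn G S x y"
  by (blast intro: conn_edge_trans conn_refl)

lemma conn_path:
  assumes "is_path G p" "set p \<subseteq> S" "x \<in> set p" "y \<in> set p"
  shows "conn G S x y"
proof -
  have "conn G S (hd p) z" if z: "z \<in> set p" for z
  proof -
    obtain q q' where "p = q @ z # q'"
      using z by (meson split_list)
    then have "p = (q @ [z]) @ q'" by simp
    then show ?thesis
      using assms is_path_append_left[of G "q @ [z]" q'] by (intro connI[of _ "q @ [z]"]) (auto simp: hd_append)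
  qed
  then show ?thesis
    using assms conn_sym conn_trans by metis
qed

section \<open>Components of induced subgraphs\<close>

definition component :: "'a ugraph \<Rightarrow> 'a set \<Rightarrow> 'a \<Rightarrow> 'a set" where
  "component G S x = {y. conn G S x y}"

lemma component_eq: "y \<in> component G S x \<Longrightarrow> component G S y = component G S x"
proof -
  assume "y \<in> component G S x"
  then have *: "conn G S x y" "conn G S y x"
    by (simp_all add: component_def conn_sym)
  have "conn G S y z \<longleftrightarrow> conn G S x z" for z
    using conn_trans[OF *(1), of z] conn_trans[OF *(2), of z] by argo
  then show ?thesis
    by (simp add: component_def)
qed

lemma component_subset: "component G S x \<subseteq> S \<inter> verts G"
  using conn_in(2,4)[of G S x] by (auto simp: component_def)

lemma component_mono: "S \<subseteq> S' \<Longrightarrow> component G S x \<subseteq> component G S' x"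
  unfolding component_def by (auto intro: conn_mono)

lemma component_refl: "x \<in> verts G \<Longrightarrow> x \<in> S \<Longrightarrow> x \<in> component G S x"
  unfolding component_def by (simp add: conn_refl)

lemma path_in_component:
  assumes "is_path G p" "set p \<subseteq> S" "z \<in> set p" "z \<in> component G S x"
  shows "set p \<subseteq> component G S x"
proof
  fix y
  assume "y \<in> set p"
  then show "y \<in> component G S x"
    using assms conn_path[OF assms(1,2,3)] unfolding component_def
    by (auto intro: conn_trans)
qed

lemma conn_in_component:
  assumes "y \<in> component G S x" "z \<in> component G S x"
  shows "conn G (component G S x) y z"
proof -
  have "conn G S y z"
    using assms unfolding component_def by (blast intro: conn_sym conn_trans)
  then obtain p where p: "is_path G p" "hd p = y" "last p = z" "set p \<subseteq> S"
    by (rule connE)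
  then have "set p \<subseteq> component G S x"
    using assms by (intro path_in_component[of G p S y]) (auto simp: is_path_iff)
  then show ?thesis
    using p by (auto intro: connI)
qed

section \<open>Trees given by ancestor lists\<close>

text \<open>\<open>anc v\<close> stands for the path from the root \<open>r\<close> to
  \<open>v\<close>, so that the tree order becomes membership in these lists.\<close>

locale ancestor_lists =
  fixes G :: "'a ugraph" and r :: 'a and W :: "'a set" and anc :: "'a \<Rightarrow> 'a list"
  assumes G: "graph G"
    and W: "W \<subseteq> verts G" "r \<in> W"
    and anc_root: "anc r = [r]"
    and anc_parent: "\<And>v. v \<in> W \<Longrightarrow> v \<noteq> r \<Longrightarrow>
      \<exists>p\<in>W. anc v = anc p @ [v] \<and> {p, v} \<in> edges G"
    and distinct_anc: "\<And>v. v \<in> W \<Longrightarrow> distinct (anc v)"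
begin

definition T :: "'a ugraph" where
  "T = \<lparr>verts = W, edges = {{p, v} | p v. p \<in> W \<and> v \<in> W \<and> anc v = anc p @ [v] \<and> {p, v} \<in> edges G}\<rparr>"

lemma verts_T [simp]: "verts T = W"
  by (simp add: T_def)

lemma subgraph_T: "subgraph T G"
  using G W unfolding subgraph_def graph_def T_def by auto

lemma anc_path: "v \<in> W \<Longrightarrow> path_between T r (anc v) v \<and> set (anc v) \<subseteq> W"
proof (induction "length (anc v)" arbitrary: v rule: less_induct)
  case less
  show ?case
  proof (cases "v = r")
    case True
    then show ?thesis
      using W by (simp add: path_between_def is_path_iff anc_root)
  next
    case False
    then obtain p where p: "p \<in> W" "anc v = anc p @ [v]" "{p, v} \<in> edges G"
      using anc_parent less.prems by blast
    then have IH: "path_between T r (anc p) p" "set (anc p) \<subseteq> W"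
      using less.hyps[of p] by auto
    have "{p, v} \<in> edges T"
      using p less.prems unfolding T_def by auto
    then show ?thesis
      using IH p less.prems distinct_anc[OF less.prems]
      by (auto simp: path_between_def is_path_iff successively_append_iff)
  qed
qed

lemma connected_T: "connected_graph T"
proof -
  have "conn T UNIV u v" if "u \<in> W" "v \<in> W" for u v
  proof -
    have "conn T UNIV r u" "conn T UNIV r v"
      using anc_path that unfolding conn_def by auto
    then show ?thesis
      by (blast intro: conn_sym conn_trans)
  qed
  then show ?thesis
    using W unfolding connected_graph_def conn_def by auto
qed

lemma edge_T_cases:
  assumes "{x, y} \<in> edges T"
  shows "anc y = anc x @ [y] \<or> anc x = anc y @ [x]"
  using assms unfolding T_def by (auto simp: doubleton_eq_iff)

text \<open>On a cycle, both neighbours of a vertex of maximal depth would be its parent.\<close>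

lemma acyclic_T: "\<not> is_cycle T c"
proof
  assume c: "is_cycle T c"
  define n where "n = length c"
  have n: "n \<ge> 3" "distinct c" "set c \<subseteq> W"
    using c by (auto simp: is_cycle_def is_path_iff n_def)
  have edge: "{c ! i, c ! (Suc i mod n)} \<in> edges T" if "i < n" for i
  proof (cases "Suc i < n")
    case True
    then show ?thesis
      using c by (auto simp: is_cycle_def is_path_iff successively_conv_nth n_def)
  next
    case False
    then have "Suc i = n" using that by simp
    then have i: "i = n - 1" "Suc i mod n = 0" by auto
    have "c \<noteq> []" using n by (auto simp: n_def)
    then have "last c = c ! i" "hd c = c ! 0"
      by (simp_all add: i n_def last_conv_nth hd_conv_nth)
    then show ?thesis
      using c i by (simp add: is_cycle_def)
  qed
  define d where "d i = length (anc (c ! i))" for i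
  have fin: "finite (d ` {..<n})" "d ` {..<n} \<noteq> {}"
    using n by (auto simp: lessThan_empty_iff)
  obtain i where i: "i < n" and "d i = Max (d ` {..<n})"
    using Max_in[OF fin] by auto
  then have max: "length (anc (c ! j)) \<le> length (anc (c ! i))" if "j < n" for j
    using Max_ge[OF fin(1), of "d j"] that by (simp add: d_def)
  have parent: "anc (c ! i) = anc (c ! j) @ [c ! i]"
    if "j < n" "{c ! i, c ! j} \<in> edges T" for j
    using edge_T_cases[OF that(2)] max[OF that(1)] by auto
  define j where "j = Suc i mod n"
  define k where "k = (if i = 0 then n - 1 else i - 1)"
  have jk: "j < n" "k < n" "j \<noteq> k" "Suc k mod n = i"
    using i n by (auto simp: j_def k_def mod_Suc)
  have "anc (c ! j) = anc (c ! k)"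
    using parent[of j] parent[of k] edge[OF i] edge[of k] jk by (auto simp: j_def insert_commute)
  then have "last (anc (c ! j)) = last (anc (c ! k))" by simp
  moreover have "c ! j \<in> W" "c ! k \<in> W"
    using jk n(3) by (auto simp: n_def)
  ultimately have "c ! j = c ! k"
    using anc_path by (simp add: path_between_def)
  then show False
    using jk n by (simp add: nth_eq_iff_index_eq n_def)
qed

lemma tree_T: "tree T"
  using subgraph_T connected_T acyclic_T by (simp add: tree_def subgraph_def)

lemma tree_le_T: "v \<in> W \<Longrightarrow> u \<in> set (anc v) \<Longrightarrow> tree_le T r u v"
  unfolding tree_le_def using anc_path by blast

lemma normal_T:
  assumes "\<And>p. is_path G p \<Longrightarrow> hd p \<in> W \<Longrightarrow> last p \<in> W \<Longrightarrow> inner_verts p \<inter> W = {} \<Longrightarrow>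
    hd p \<in> set (anc (last p)) \<or> last p \<in> set (anc (hd p))"
  shows "normal_tree G T r"
  unfolding normal_tree_def
proof (intro conjI allI impI)
  fix p
  assume "T_path G T p"
  then have p: "is_path G p" "hd p \<in> W" "last p \<in> W" "inner_verts p \<inter> W = {}"
    by (simp_all add: T_path_def)
  show "tree_le T r (hd p) (last p) \<or> tree_le T r (last p) (hd p)"
    using assms[OF p] tree_le_T[OF p(2)] tree_le_T[OF p(3)] by metis
qed (simp_all only: subgraph_T tree_T W verts_T)

end

text \<open>A path never returns to its first vertex, so its second vertex is still joined to
  \<open>y\<close> after \<open>x\<close> is deleted.\<close>

lemma edge_into_component:
  assumes "conn G S x y" "x \<noteq> y"
  shows "\<exists>w\<in>component G (S - {x}) y. {x, w} \<in> edges G"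
proof -
  obtain p where p: "is_path G p" "hd p = x" "last p = y" "set p \<subseteq> S"
    using assms(1) by (rule connE)
  obtain q where q: "p = x # q"
    using p by (cases p) (auto simp: is_path_iff)
  then have "q \<noteq> []"
    using p assms(2) by auto
  then have q': "is_path G q" "x \<notin> set q" "{x, hd q} \<in> edges G" "last q = y"
    using p q by (auto simp: is_path_Cons)
  then have "conn G (S - {x}) (hd q) y"
    using p q by (intro connI[of G q]) auto
  then show ?thesis
    using q' unfolding component_def by (auto intro: conn_sym)
qed

section \<open>Normal trees from a search strategy\<close>

text \<open>
  Every vertex \<open>v\<close> runs its own search: a chain of vertices starting at \<open>r\<close> is extended
  by the choice of \<open>nxt\<close> in the component of \<open>v\<close> in the complement of the chain, until
  \<open>v\<close> itself is chosen. Vertices in the same component make the same choices, so that the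
  chains are the branches of a tree; different components yield incomparable branches, so that
  the tree is normal.
\<close>

locale search =
  fixes G :: "'a ugraph" and r :: 'a and nxt :: "'a list \<Rightarrow> 'a set \<Rightarrow> 'a"
  assumes graph: "graph G" and connected: "connected_graph G" and root: "r \<in> verts G"
    and nxt: "\<And>c v. c \<noteq> [] \<Longrightarrow> v \<in> verts G - set c \<Longrightarrow> last c \<in> verts G \<Longrightarrow>
      \<exists>w\<in>component G (- set c) v. {last c, w} \<in> edges G \<Longrightarrow>
      nxt c (component G (- set c) v) \<in> component G (- set c) v \<and>
      {last c, nxt c (component G (- set c) v)} \<in> edges G"
begin

primrec chain :: "nat \<Rightarrow> 'a \<Rightarrow> 'a list" where
  "chain 0 v = [r]"
| "chain (Suc n) v = (if v \<in> set (chain n v) then chain n v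
     else chain n v @ [nxt (chain n v) (component G (- set (chain n v)) v)])"

abbreviation D :: "nat \<Rightarrow> 'a \<Rightarrow> 'a set" where
  "D n v \<equiv> component G (- set (chain n v)) v"

lemma chain_nonempty [simp]: "chain n v \<noteq> []"
  by (induction n) auto

lemma chain_mono: "m \<le> n \<Longrightarrow> set (chain m v) \<subseteq> set (chain n v)"
  by (rule lift_Suc_mono_le[of "\<lambda>n. set (chain n v)"]) auto

lemma chain_stable: "v \<in> set (chain m v) \<Longrightarrow> m \<le> n \<Longrightarrow> chain n v = chain m v"
  by (induction n) (auto simp: le_Suc_eq)

lemma length_chain: "v \<notin> set (chain n v) \<Longrightarrow> length (chain n v) = Suc n"
  by (induction n) (auto split: if_splits)

text \<open>Until \<open>v\<close> is reached every stage appends exactly one vertex to the initial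
  \<open>[r]\<close>. Thus a search can read off its earlier stages from the current chain.\<close>

lemma take_chain: "v \<notin> set (chain n v) \<Longrightarrow> m \<le> n \<Longrightarrow> take (Suc m) (chain n v) = chain m v"
proof (induction n)
  case (Suc n)
  then have "v \<notin> set (chain n v)" by (auto split: if_splits)
  then show ?case
    using Suc length_chain[of v n] length_chain[of v "Suc n"]
    by (cases "m = Suc n") auto
qed simp

lemma D_antimono: "m \<le> n \<Longrightarrow> D n v \<subseteq> D m v"
  by (rule component_mono) (simp add: chain_mono)

text \<open>Both claims need one induction: \<open>nxt\<close> is only controlled when the last
  vertex has a neighbour in the current component, and the chosen vertex has one in the next
  component because it was connected to \<open>v\<close> in the old one.\<close>

lemma chain_invariant:
  assumes "v \<in> verts G"
  shows "is_path G (chain n v) \<and>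
    (v \<notin> set (chain n v) \<longrightarrow> (\<exists>w\<in>D n v. {last (chain n v), w} \<in> edges G))"
proof (induction n)
  case 0
  have "conn G UNIV r v"
    using connected assms root unfolding connected_graph_def conn_def by auto
  then show ?case
    using root edge_into_component[of G UNIV r v] by (auto simp: is_path_iff Compl_eq_Diff_UNIV)
next
  case (Suc n)
  show ?case
  proof (cases "v \<in> set (chain n v)")
    case False
    define c where "c = chain n v"
    define s where "s = nxt c (component G (- set c) v)"
    have c: "v \<notin> set c" "chain (Suc n) v = c @ [s]" "is_path G c" "c \<noteq> []"
      using False Suc by (auto simp: c_def s_def)
    then have "last c \<in> verts G"
      by (auto simp: is_path_iff)
    then have s: "s \<in> component G (- set c) v" "{last c, s} \<in> edges G"
      using nxt[of c v] False Suc assms by (auto simp: c_def s_def)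
    have "s \<in> verts G" "s \<notin> set c"
      using s(1) component_subset[of G "- set c" v] by auto
    then have "is_path G (c @ [s])"
      using c s by (auto simp: is_path_iff successively_append_iff)
    moreover have "\<exists>w\<in>component G (- set (c @ [s])) v. {s, w} \<in> edges G" if "v \<noteq> s"
    proof -
      have "conn G (- set c) s v"
        using s(1) by (simp add: component_def conn_sym)
      moreover have "- set (c @ [s]) = - set c - {s}"
        by auto
      ultimately show ?thesis
        using edge_into_component[of G "- set c" s v] that by simp
    qed
    ultimately show ?thesis
      unfolding c(2) by auto
  qed (use Suc in auto)
qed

lemma chain_path: "v \<in> verts G \<Longrightarrow> is_path G (chain n v)"
  using chain_invariant by blast

lemma chain_attached:
  "v \<in> verts G \<Longrightarrow> v \<notin> set (chain n v) \<Longrightarrow> \<exists>w\<in>D n v. {last (chain n v), w} \<in> edges G"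
  using chain_invariant by blast

lemma nxt_chain:
  assumes "v \<in> verts G" "v \<notin> set (chain n v)"
  shows "nxt (chain n v) (D n v) \<in> D n v" "{last (chain n v), nxt (chain n v) (D n v)} \<in> edges G"
proof -
  have "last (chain n v) \<in> verts G"
    using chain_path[OF assms(1), of n] last_in_set[of "chain n v"] by (auto simp: is_path_iff)
  then show "nxt (chain n v) (D n v) \<in> D n v" "{last (chain n v), nxt (chain n v) (D n v)} \<in> edges G"
    using nxt[of "chain n v" v] chain_attached assms by auto
qed

text \<open>\<open>nxt\<close> sees the chain and the component but not \<open>v\<close>. As
  \<open>w\<close> lies in all the earlier, larger components of \<open>v\<close>, both searches
  make the same choices.\<close>

lemma chain_cong: "w \<in> D n v \<Longrightarrow> v \<notin> set (chain n v) \<Longrightarrow> chain n w = chain n v"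
proof (induction n)
  case (Suc n)
  have w: "w \<in> D n v"
    using D_antimono[OF le_SucI[OF le_refl]] Suc.prems(1) by (rule subsetD)
  have v: "v \<notin> set (chain n v)"
    using Suc.prems(2) by (auto split: if_splits)
  have IH: "chain n w = chain n v"
    using Suc.IH w v by blast
  have "w \<notin> set (chain n v)"
    using w component_subset[of G] by fast
  moreover have "component G (- set (chain n v)) w = D n v"
    using w by (rule component_eq)
  ultimately show ?case
    using v IH by simp
qed simp

section \<open>The tree formed by the branches\<close>

definition W :: "'a set" where
  "W = {v \<in> verts G. \<exists>n. v \<in> set (chain n v)}"

definition anc :: "'a \<Rightarrow> 'a list" where
  "anc v = chain (LEAST n. v \<in> set (chain n v)) v"

lemma anc_eq:
  assumes "v \<in> set (chain n v)"
  shows "anc v = chain n v"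
proof -
  let ?m = "LEAST n. v \<in> set (chain n v)"
  have "v \<in> set (chain ?m v)" "?m \<le> n"
    using assms by (auto intro: LeastI Least_le)
  then show ?thesis
    unfolding anc_def by (metis chain_stable)
qed

text \<open>The newest vertex \<open>s\<close> of a chain is taken from the component of
  \<open>v\<close>, so the search for \<open>s\<close> has run identically so far and stops with
  this very choice.\<close>

lemma last_chain:
  assumes "v \<in> verts G"
  shows "last (chain n v) \<in> W \<and> anc (last (chain n v)) = chain n v"
proof (induction n)
  case 0
  have r: "r \<in> set (chain 0 r)" by simp
  then have "r \<in> W"
    using root unfolding W_def by blast
  then show ?case
    using anc_eq[OF r] by simp
next
  case (Suc n)
  show ?case
  proof (cases "v \<in> set (chain n v)")
    case False
    define s where "s = nxt (chain n v) (D n v)"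
    have s: "s \<in> D n v"
      unfolding s_def using assms False by (rule nxt_chain)
    have eq: "chain n s = chain n v" "D n s = D n v"
      using chain_cong[OF s False] component_eq[OF s] by simp_all
    have "s \<in> verts G" "s \<notin> set (chain n v)"
      using s component_subset[of G] by fast+
    then have "chain (Suc n) s = chain (Suc n) v" "s \<in> set (chain (Suc n) s)"
      using False eq by (simp_all add: s_def)
    then have "s \<in> W" "anc s = chain (Suc n) v"
      using \<open>s \<in> verts G\<close> anc_eq[of s "Suc n"] unfolding W_def by (blast, argo)
    then show ?thesis
      using False by (simp add: s_def)
  qed (use Suc in auto)
qed

lemma set_chain_subset_W: "v \<in> verts G \<Longrightarrow> set (chain n v) \<subseteq> W"
proof (induction n)
  case 0
  then show ?case
    using last_chain[of v 0] by simp
next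
  case (Suc n)
  then show ?case
    using last_chain[of v "Suc n"] by (auto split: if_splits)
qed

sublocale ancestor_lists G r W anc
proof
  show "graph G" by (rule graph)
  show "W \<subseteq> verts G" by (auto simp: W_def)
  show "r \<in> W" "anc r = [r]"
    using last_chain[OF root, of 0] by simp_all
  show "distinct (anc v)" if "v \<in> W" for v
    using that chain_path[of v] by (auto simp: W_def anc_def is_path_iff)
  show "\<exists>p\<in>W. anc v = anc p @ [v] \<and> {p, v} \<in> edges G" if "v \<in> W" and neq: "v \<noteq> r" for v
  proof -
    define m where "m = (LEAST n. v \<in> set (chain n v))"
    have v: "v \<in> verts G" and m: "v \<in> set (chain m v)"
      using that(1) by (auto simp: W_def m_def intro: LeastI)
    obtain n where n: "m = Suc n"
      using m neq by (cases m) auto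
    have "v \<notin> set (chain n v)"
      using n not_less_Least[of n "\<lambda>n. v \<in> set (chain n v)"] by (simp add: m_def)
    moreover from this have "nxt (chain n v) (D n v) = v"
      using m n by (auto split: if_splits)
    ultimately have "anc v = chain n v @ [v]" "{last (chain n v), v} \<in> edges G"
      using n nxt_chain[OF v, of n] by (simp_all add: anc_def m_def)
    then show ?thesis
      using last_chain[OF v, of n] by metis
  qed
qed

text \<open>Suppose neither end of the path is an ancestor of the other. A chain common to both ends
  contains neither, hence misses the whole path, which keeps both ends in one component. So the two
  searches never diverge, although the one for \<open>x\<close> reaches \<open>x\<close>.\<close>

theorem normal_tree_T: "normal_tree G T r"
proof (rule normal_T)
  fix p
  assume p: "is_path G p" "hd p \<in> W" "last p \<in> W" "inner_verts p \<inter> W = {}"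
  define x y where "x = hd p" and "y = last p"
  have xy: "x \<in> W" "y \<in> W" "x \<in> verts G" "y \<in> verts G" and "p \<noteq> []"
    using p by (auto simp: x_def y_def W_def is_path_iff)
  have set_p: "set p \<inter> W \<subseteq> {x, y}" "x \<in> set p" "y \<in> set p"
    using set_path_eq_inner_verts[OF \<open>p \<noteq> []\<close>] p(4) by (auto simp: x_def y_def)
  have anc: "set (chain n v) \<subseteq> set (anc v)" if v: "v \<in> W" for v n
  proof -
    obtain m where m: "v \<in> set (chain m v)"
      using v by (auto simp: W_def)
    have "set (chain n v) \<subseteq> set (chain (max n m) v)"
      by (rule chain_mono) simp
    also have "chain (max n m) v = anc v"
      using chain_stable[OF m, of "max n m"] anc_eq[OF m] by simp
    finally show ?thesis .
  qed
  show "hd p \<in> set (anc (last p)) \<or> last p \<in> set (anc (hd p))"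
  proof (rule ccontr)
    assume "\<not> ?thesis"
    then have neq: "x \<notin> set (anc y)" "y \<notin> set (anc x)"
      by (auto simp: x_def y_def)
    have eq: "chain n x = chain n y" for n
    proof (induction n)
      case (Suc n)
      have "x \<notin> set (chain n y)" "y \<notin> set (chain n x)"
        using neq anc xy by blast+
      moreover have "conn G (- set (chain n y)) y x"
        using p(1)
      proof (rule conn_path)
        show "set p \<subseteq> - set (chain n y)"
          using set_chain_subset_W[OF xy(4), of n] set_p Suc calculation by auto
      qed (use set_p in auto)
      then have "D n x = D n y"
        using Suc component_eq[of x G] by (simp add: component_def)
      ultimately show ?case
        using Suc by simp
    qed simp
    obtain n where "x \<in> set (chain n x)"
      using xy(1) by (auto simp: W_def)
    then show False
      using eq[of n] neq anc[OF xy(2), of n] by auto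
  qed
qed

end

section \<open>Independent paths and fat subdivisions\<close>

lemma ex_maximal_pairwise: "\<exists>M\<subseteq>A. pairwise R M \<and> (\<forall>x\<in>A. pairwise R (insert x M) \<longrightarrow> x \<in> M)"
proof -
  have "\<exists>M\<in>{M. M \<subseteq> A \<and> pairwise R M}. \<forall>X\<in>{M. M \<subseteq> A \<and> pairwise R M}. M \<subseteq> X \<longrightarrow> X = M"
  proof (rule subset_Zorn')
    fix \<C>
    assume chain: "subset.chain {M. M \<subseteq> A \<and> pairwise R M} \<C>"
    have "R x y" if "X \<in> \<C>" "Y \<in> \<C>" "x \<in> X" "y \<in> Y" "x \<noteq> y" for X Y x y
    proof -
      have "X \<subseteq> Y \<or> Y \<subseteq> X" "pairwise R X" "pairwise R Y"
        using chain that(1,2) by (auto simp: subset_chain_def)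
      then show ?thesis
        using that by (meson pairwiseD subsetD)
    qed
    then show "\<Union>\<C> \<in> {M. M \<subseteq> A \<and> pairwise R M}"
      using chain by (auto simp: subset_chain_def pairwise_def)
  qed
  then obtain M where "M \<in> {M. M \<subseteq> A \<and> pairwise R M}"
    and max: "\<forall>X\<in>{M. M \<subseteq> A \<and> pairwise R M}. M \<subseteq> X \<longrightarrow> X = M"
    by (rule bexE)
  then have M: "M \<subseteq> A" "pairwise R M"
    by simp_all
  have "x \<in> M" if "x \<in> A" "pairwise R (insert x M)" for x
    using bspec[OF max, of "insert x M"] M(1) that by auto
  then show ?thesis
    using M by (intro exI[of _ M]) simp
qed

text \<open>Otherwise a choice of one point of \<open>C\<close> in each of the disjoint sets
  \<open>I p\<close> would embed \<open>F\<close> into \<open>C\<close>.\<close>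

lemma uncountable_disjoint_family_avoids:
  assumes "uncountable F" "countable C"
    and "\<And>p q. p \<in> F \<Longrightarrow> q \<in> F \<Longrightarrow> p \<noteq> q \<Longrightarrow> I p \<inter> I q = {}"
  obtains p where "p \<in> F" "I p \<inter> C = {}"
proof -
  have "\<exists>p\<in>F. I p \<inter> C = {}"
  proof (rule ccontr)
    assume "\<not> ?thesis"
    then have "\<forall>p\<in>F. \<exists>x. x \<in> I p \<inter> C" by blast
    then obtain f where f: "\<And>p. p \<in> F \<Longrightarrow> f p \<in> I p \<inter> C"
      by metis
    have "inj_on f F"
      using f assms(3) by (fastforce simp: inj_on_def)
    moreover have "countable (f ` F)"
      using f by (intro countable_subset[OF _ assms(2)]) auto
    ultimately show False
      using assms(1) countable_image_inj_on by blast
  qed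
  then show ?thesis
    using that by blast
qed

text \<open>A cardinal exceeds each of its proper initial segments, and whatever is smaller than the
  successor of \<open>\<aleph>\<^sub>0\<close> is countable.\<close>

lemma wf_cardSuc_natLeq: "wf (cardSuc natLeq - Id)"
  and total_cardSuc_natLeq: "\<alpha> \<in> Field (cardSuc natLeq) \<Longrightarrow> \<beta> \<in> Field (cardSuc natLeq) \<Longrightarrow> \<alpha> \<noteq> \<beta> \<Longrightarrow>
    (\<alpha>, \<beta>) \<in> cardSuc natLeq - Id \<or> (\<beta>, \<alpha>) \<in> cardSuc natLeq - Id"
  and countable_below_cardSuc_natLeq: "\<alpha> \<in> Field (cardSuc natLeq) \<Longrightarrow>
    countable {\<beta>. (\<beta>, \<alpha>) \<in> cardSuc natLeq - Id}"
proof -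
  have card: "Card_order (cardSuc natLeq)"
    by (rule cardSuc_Card_order[OF natLeq_Card_order])
  then have wo: "Well_order (cardSuc natLeq)"
    by (simp add: card_order_on_def)
  then show "wf (cardSuc natLeq - Id)"
    by (simp add: well_order_on_def)
  show "(\<alpha>, \<beta>) \<in> cardSuc natLeq - Id \<or> (\<beta>, \<alpha>) \<in> cardSuc natLeq - Id"
    if "\<alpha> \<in> Field (cardSuc natLeq)" "\<beta> \<in> Field (cardSuc natLeq)" "\<alpha> \<noteq> \<beta>"
    using wo that by (auto simp: well_order_on_def linear_order_on_def total_on_def)
  show "countable {\<beta>. (\<beta>, \<alpha>) \<in> cardSuc natLeq - Id}" if "\<alpha> \<in> Field (cardSuc natLeq)"
  proof -
    have "{\<beta>. (\<beta>, \<alpha>) \<in> cardSuc natLeq - Id} = underS (cardSuc natLeq) \<alpha>"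
      by (auto simp: underS_def)
    moreover have "countable (underS (cardSuc natLeq) \<alpha>)"
      unfolding countable_card_le_natLeq
      by (rule iffD1[OF cardSuc_ordLeq_ordLess[OF natLeq_Card_order card_of_Card_order]
            card_of_underS[OF card that]])
    ultimately show ?thesis
      by simp
  qed
qed

text \<open>
  The parallel paths are chosen by recursion along the order type \<open>\<omega>\<^sub>1\<close>: at each stage
  only countably many vertices have been used, so that an uncountable family of independent paths
  still contains one that avoids all of them.
\<close>

lemma fat_TK_if_uncountable_families:
  fixes b :: "nat \<Rightarrow> 'a"
  assumes G: "graph G" and b: "inj b" "range b \<subseteq> verts G"
    and F: "\<And>i j. i \<noteq> j \<Longrightarrow> uncountable (F {i, j})"
    and path: "\<And>e p. p \<in> F e \<Longrightarrow>
      is_path G p \<and> {hd p, last p} = b ` e \<and> inner_verts p \<noteq> {}"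
    and disj: "\<And>e p q. p \<in> F e \<Longrightarrow> q \<in> F e \<Longrightarrow> p \<noteq> q \<Longrightarrow> inner_verts p \<inter> inner_verts q = {}"
  obtains H where "fat_TK_in G H" "range b \<subseteq> verts H"
proof -
  define E :: "nat set set" where "E = {{i, j} | i j. i \<noteq> j}"
  have "E \<subseteq> (\<lambda>(i, j). {i, j}) ` UNIV"
    unfolding E_def by auto
  then have E: "countable E"
    by (rule countable_subset) simp
  define \<omega> where "\<omega> = cardSuc natLeq - Id"
  define I where "I = E \<times> Field (cardSuc natLeq)"
  \<comment> \<open>The edges of the fat clique are ordered by their position in
    \<open>cardSuc natLeq\<close> and only then by the number of their pair of ends; this leaves
    countably many predecessors of each edge.\<close>
  define R where "R = inv_image (\<omega> <*lex*> less_than) (\<lambda>(e, \<alpha>). (\<alpha>, to_nat_on E e))"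
  have wf: "wf R"
    unfolding R_def \<omega>_def by (intro wf_inv_image wf_lex_prod wf_cardSuc_natLeq wf_less_than)
  have total: "(x, y) \<in> R \<or> (y, x) \<in> R" if "x \<in> I" "y \<in> I" "x \<noteq> y" for x y
  proof -
    obtain e \<alpha> f \<beta> where xy: "x = (e, \<alpha>)" "y = (f, \<beta>)"
      by fastforce
    show ?thesis
    proof (cases "\<alpha> = \<beta>")
      case True
      then have "to_nat_on E e \<noteq> to_nat_on E f"
        using that xy E inj_on_to_nat_on[OF E] by (auto simp: I_def inj_on_def)
      then show ?thesis
        using True by (auto simp: xy R_def)
    next
      case False
      then show ?thesis
        using that total_cardSuc_natLeq[of \<alpha> \<beta>] by (auto simp: xy I_def R_def \<omega>_def)
    qed
  qed
  have below: "countable {y \<in> I. (y, x) \<in> R}" if "x \<in> I" for x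
  proof -
    obtain e \<alpha> where x: "x = (e, \<alpha>)"
      by fastforce
    have "{y \<in> I. (y, x) \<in> R} \<subseteq> E \<times> insert \<alpha> {\<beta>. (\<beta>, \<alpha>) \<in> \<omega>}"
      by (auto simp: x I_def R_def)
    then show ?thesis
      using E countable_below_cardSuc_natLeq[of \<alpha>] that
      by (elim countable_subset) (auto simp: x I_def \<omega>_def)
  qed
  define P where "P f x q \<longleftrightarrow> (x \<in> I \<longrightarrow> q \<in> F (fst x) \<and> inner_verts q \<inter> range b = {} \<and>
    (\<forall>y\<in>I. (y, x) \<in> R \<longrightarrow> inner_verts q \<inter> inner_verts (f y) = {}))" for f x q
  have "\<exists>f. \<forall>x. P f x (f x)"
  proof (rule dependent_wf_choice[OF wf])
    fix x and f :: "nat set \<times> nat set \<Rightarrow> 'a list"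
    define C where "C = range b \<union> (\<Union>y\<in>{y \<in> I. (y, x) \<in> R}. inner_verts (f y))"
    show "\<exists>q. P f x q"
    proof (cases "x \<in> I")
      case True
      then have "uncountable (F (fst x))"
        using F by (auto simp: I_def E_def)
      moreover have "countable C"
        unfolding C_def
        by (intro countable_Un countable_UN below True) (auto simp: inner_verts_def countable_finite)
      ultimately obtain q where "q \<in> F (fst x)" "inner_verts q \<inter> C = {}"
        using disj[of _ "fst x"] by (rule uncountable_disjoint_family_avoids)
      then have "P f x q"
        by (auto simp: P_def C_def)
      then show ?thesis ..
    qed (simp add: P_def)
  qed (simp add: P_def)
  then obtain p where p: "\<And>x. P p x (p x)"
    by blast
  have p_F: "p x \<in> F (fst x)" and p_b: "inner_verts (p x) \<inter> range b = {}" if "x \<in> I" for x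
    using p[of x] that by (auto simp: P_def)
  have p_inner: "inner_verts (p x) \<inter> inner_verts (p y) = {}" if "x \<in> I" "y \<in> I" "x \<noteq> y" for x y
    using p[of x] p[of y] total[OF that] that by (auto simp: P_def)
  have p_path: "is_path G (p x)" "{hd (p x), last (p x)} = b ` fst x" "inner_verts (p x) \<noteq> {}"
    if "x \<in> I" for x
    using path[OF p_F[OF that]] by auto
  have p_set: "set (p x) \<subseteq> range b \<union> inner_verts (p x)" if "x \<in> I" for x
  proof -
    have "hd (p x) \<in> range b" "last (p x) \<in> range b"
      using p_path(2)[OF that] by auto
    then show ?thesis
      using set_path_eq_inner_verts[of "p x"] p_path(1)[OF that] by (auto simp: is_path_iff)
  qed
  have p_edges: "path_edges (p x) \<inter> path_edges (p y) = {}" if xy: "x \<in> I" "y \<in> I" "x \<noteq> y" for x y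
  proof (rule ccontr)
    assume "\<not> ?thesis"
    then obtain d where "d \<in> path_edges (p x)" "d \<in> path_edges (p y)"
      by blast
    then have "d \<inter> inner_verts (p x) \<noteq> {}" "d \<subseteq> set (p y)"
      using path_edge_meets_inner_verts p_path(3) xy by metis+
    then show False
      using p_set[OF xy(2)] p_b[OF xy(1)] p_inner[OF xy] by blast
  qed
  define H where "H = \<lparr>verts = range b \<union> (\<Union>x\<in>I. set (p x)), edges = (\<Union>x\<in>I. path_edges (p x))\<rparr>"
  have "path_edges (p x) \<subseteq> edges G" "set (p x) \<subseteq> verts G" if "x \<in> I" for x
    using p_path(1)[OF that] by (auto simp: is_path_def)
  then have sub: "verts H \<subseteq> verts G" "edges H \<subseteq> edges G"
    unfolding H_def using b(2) by (simp_all add: UN_subset_iff)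
  have "graph H"
    unfolding graph_def
  proof
    fix d
    assume d: "d \<in> edges H"
    then obtain x where "x \<in> I" "d \<in> path_edges (p x)"
      by (auto simp: H_def)
    then have "d \<subseteq> set (p x)"
      using path_edge_meets_inner_verts p_path(3) by metis
    then show "d \<subseteq> verts H \<and> card d = 2"
      using \<open>x \<in> I\<close> d sub(2) G by (auto simp: H_def graph_def)
  qed
  then have "subgraph H G"
    using sub by (simp add: subgraph_def)
  moreover have "subdivision_of fat_K H"
    unfolding subdivision_of_def
  proof (intro exI conjI ballI impI)
    have fat_K: "mverts fat_K = UNIV" "medges fat_K = I" "mends fat_K = fst"
      by (simp_all add: fat_K_def I_def E_def)
    show "inj_on b (mverts fat_K)"
      using b by (simp add: fat_K)
    show "verts H = b ` mverts fat_K \<union> (\<Union>e\<in>medges fat_K. set (p e))"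
      and "edges H = (\<Union>e\<in>medges fat_K. path_edges (p e))"
      by (simp_all add: H_def fat_K)
    fix x
    assume x: "x \<in> medges fat_K"
    show "is_path H (p x)"
      using p_path(1)[of x] x by (auto simp: H_def fat_K is_path_def)
    show "{hd (p x), last (p x)} = b ` mends fat_K x" "inner_verts (p x) \<inter> b ` mverts fat_K = {}"
      using p_path(2)[of x] p_b[of x] x by (simp_all add: fat_K)
    fix y
    assume y: "y \<in> medges fat_K" "x \<noteq> y"
    show "inner_verts (p x) \<inter> inner_verts (p y) = {}" "path_edges (p x) \<inter> path_edges (p y) = {}"
      using p_inner[of x y] p_edges[of x y] x y by (simp_all add: fat_K)
  qed
  ultimately have "fat_TK_in G H"
    by (simp add: fat_TK_in_def)
  moreover have "range b \<subseteq> verts H"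
    by (simp add: H_def)
  ultimately show ?thesis
    by (rule that)
qed

section \<open>The ray of a vertex that is never reached\<close>

context search
begin

context
  fixes v :: 'a
  assumes v: "v \<in> verts G" "v \<notin> W"
begin

text \<open>As \<open>v\<close> is never reached, every chain is a proper prefix of the next one;
  their last vertices trace out the infinite branch along which \<open>v\<close> is missed.\<close>

definition ray :: "nat \<Rightarrow> 'a" where
  "ray n = last (chain n v)"

abbreviation D\<^sub>\<omega> :: "'a set" where
  "D\<^sub>\<omega> \<equiv> component G (- range ray) v"

lemma not_in_chain: "v \<notin> set (chain n v)"
  using v by (auto simp: W_def)

lemma v_in_D: "v \<in> D n v"
  using v(1) not_in_chain by (intro component_refl) auto

lemma chain_Suc: "chain (Suc n) v = chain n v @ [ray (Suc n)]"
  using not_in_chain by (simp add: ray_def)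

lemma ray_Suc:
  "ray (Suc n) = nxt (chain n v) (D n v)"
  "ray (Suc n) \<in> D n v"
  "{ray n, ray (Suc n)} \<in> edges G"
  using not_in_chain nxt_chain[OF v(1), of n] by (simp_all add: ray_def)

lemma set_chain: "set (chain n v) = ray ` {..n}"
proof (induction n)
  case 0
  then show ?case by (simp add: ray_def)
next
  case (Suc n)
  then show ?case unfolding chain_Suc by (simp add: atMost_Suc)
qed

lemma ray_in_verts: "ray n \<in> verts G"
  using chain_path[OF v(1), of n] set_chain[of n] by (auto simp: is_path_iff)

lemma inj_ray: "inj ray"
proof (rule linorder_injI)
  fix m n :: nat
  assume "m < n"
  then obtain k where k: "n = Suc k" "m \<le> k"
    by (cases n) auto
  have "ray n \<notin> set (chain k v)"
    using ray_Suc(2)[of k] component_subset[of G "- set (chain k v)"] k by blast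
  then show "ray m \<noteq> ray n"
    using k by (metis atMost_iff image_eqI set_chain)
qed

lemma D_omega_subset: "D\<^sub>\<omega> \<subseteq> D n v"
  by (rule component_mono) (auto simp: set_chain)

lemma not_in_ray: "v \<notin> range ray"
  using not_in_chain by (auto simp: set_chain)

text \<open>If all these indices were at most \<open>m\<close>, follow a path from \<open>v\<close>
  to \<open>ray (Suc m)\<close> that avoids the chain of stage \<open>m\<close>, up to its first
  vertex on the ray. That vertex has an index beyond \<open>m\<close>, and its predecessor on the
  path lies in \<open>D\<^sub>\<omega>\<close>.\<close>

lemma infinite_ray_neighbours: "infinite {n. \<exists>w\<in>D\<^sub>\<omega>. {ray n, w} \<in> edges G}" (is "infinite ?I")
proof
  assume "finite ?I"
  then obtain m where m: "?I \<subseteq> {..m}"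
    using finite_nat_iff_bounded_le by blast
  have "conn G (- set (chain m v)) v (ray (Suc m))"
    using ray_Suc(2)[of m] by (simp add: component_def)
  then obtain p where p: "is_path G p" "hd p = v" "last p = ray (Suc m)" "set p \<subseteq> - set (chain m v)"
    by (rule connE)
  have "last p \<in> set p"
    using p(1) by (simp add: is_path_iff)
  then have "\<exists>x\<in>set p. x \<in> range ray"
    using p(3) by (intro bexI[of _ "last p"]) simp_all
  then obtain xs x ys where split: "p = xs @ x # ys" "x \<in> range ray" "\<forall>y\<in>set xs. y \<notin> range ray"
    using split_list_first_prop[of p "\<lambda>x. x \<in> range ray"] by blast
  have xs: "xs \<noteq> []"
    using split(1,2) p(2) not_in_ray by (cases xs) auto
  obtain k where k: "x = ray k"
    using split(2) by blast
  have "k > m"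
    using p(4) split(1) k by (auto simp: set_chain not_le[symmetric])
  moreover have "conn G (- range ray) v (last xs)"
    using xs split p is_path_append_left[of G xs "x # ys"]
    by (intro connI[of G xs]) auto
  then have "last xs \<in> D\<^sub>\<omega>"
    by (simp add: component_def)
  moreover have "{ray k, last xs} \<in> edges G"
    using p(1) split(1) xs k by (simp add: is_path_iff successively_append_iff insert_commute)
  ultimately show False
    using m by fastforce
qed

text \<open>Take a path from \<open>z\<close> inside \<open>D n v\<close> that ends at
  \<open>ray (Suc n)\<close>. Before its last vertex it avoids the chain of stage
  \<open>Suc n\<close>; if it touched \<open>D (Suc n) v\<close>, then \<open>z\<close> would lie
  there too.\<close>

lemma conn_cut_off:
  assumes "z \<in> D n v - D (Suc n) v"
  shows "conn G (D n v - D (Suc n) v) z (ray (Suc n))"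
proof -
  have "conn G (D n v) z (ray (Suc n))"
    using assms ray_Suc(2) by (intro conn_in_component) auto
  then obtain p where p: "is_path G p" "hd p = z" "last p = ray (Suc n)" "set p \<subseteq> D n v"
    by (rule connE)
  have "w \<notin> D (Suc n) v" if wp: "w \<in> set p" for w
  proof
    assume w: "w \<in> D (Suc n) v"
    then have "w \<notin> set (chain (Suc n) v)"
      using component_subset[of G "- set (chain (Suc n) v)" v] by blast
    then have neq: "w \<noteq> ray (Suc n)"
      by (simp add: chain_Suc del: chain.simps)
    obtain xs ys where split: "p = xs @ w # ys"
      using wp by (meson split_list)
    have path: "is_path G (xs @ [w])"
      using p(1) split is_path_append_left[of G "xs @ [w]" ys] by simp
    have "ys \<noteq> []"
      using p(3) split neq by auto
    then have "ray (Suc n) \<in> set ys"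
      using p(3) split last_in_set[of ys] by simp
    then have "ray (Suc n) \<notin> set (xs @ [w])"
      using p(1) split by (auto simp: is_path_iff)
    moreover have "set (xs @ [w]) \<subseteq> - set (chain n v)"
      using p(4) split component_subset[of G "- set (chain n v)" v] by auto
    ultimately have sub: "set (xs @ [w]) \<subseteq> - set (chain (Suc n) v)"
      by (auto simp: chain_Suc simp del: chain.simps)
    have "set (xs @ [w]) \<subseteq> D (Suc n) v"
      using path_in_component[OF path sub _ w] by simp
    then have "hd (xs @ [w]) \<in> D (Suc n) v"
      using hd_in_set[of "xs @ [w]"] by blast
    then show False
      using assms p(2) split by (simp add: hd_append del: chain.simps split: if_splits)
  qed
  then show ?thesis
    using p by (intro connI[of G p]) (auto simp del: chain.simps)
qed

lemma ray_cut_off: "ray (Suc n) \<in> D n v - D (Suc n) v"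
proof -
  have "ray (Suc n) \<in> set (chain (Suc n) v)"
    by (simp add: chain_Suc del: chain.simps)
  then show ?thesis
    using ray_Suc(2) component_subset[of G "- set (chain (Suc n) v)" v] by blast
qed

text \<open>The sets \<open>D n v - D (Suc n) v\<close> are disjoint, so beyond some
  \<open>N\<close> they all avoid \<open>X\<close>, and with them the tail of the ray. From a vertex
  of \<open>U\<close> in a late such set, \<open>conn_cut_off\<close> leads to the ray, and the ray
  leads back to \<open>ray k\<close> for some \<open>k\<close> in \<open>I\<close> beyond
  \<open>N\<close>.\<close>

lemma not_separated:
  assumes X: "finite X" and I: "infinite I"
    and U: "\<And>n. \<exists>m\<ge>n. U \<inter> (D m v - D (Suc m) v) \<noteq> {}"
  shows "\<exists>k\<in>I. \<exists>z\<in>U. conn G (- X) z (ray k)"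
proof -
  have "\<forall>x\<in>X. \<forall>\<^sub>F n in sequentially. x \<notin> D n v - D (Suc n) v"
  proof
    fix x
    show "\<forall>\<^sub>F n in sequentially. x \<notin> D n v - D (Suc n) v"
    proof (cases "\<forall>n. x \<in> D n v")
      case False
      then obtain m where "x \<notin> D m v" by blast
      then have "x \<notin> D n v" if "n \<ge> m" for n
        using D_antimono[OF that] by blast
      then show ?thesis
        unfolding eventually_sequentially by blast
    qed (simp del: chain.simps)
  qed
  then have "\<forall>\<^sub>F n in sequentially. \<forall>x\<in>X. x \<notin> D n v - D (Suc n) v"
    by (rule eventually_ball_finite[OF X])
  then obtain N where "\<forall>n\<ge>N. \<forall>x\<in>X. x \<notin> D n v - D (Suc n) v"
    unfolding eventually_sequentially by (rule exE)
  then have N: "D n v - D (Suc n) v \<subseteq> - X" if "n \<ge> N" for n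
    using that by blast
  have ray_X: "ray n \<notin> X" if n: "n > N" for n
  proof -
    obtain m where "n = Suc m" "m \<ge> N"
      using n by (cases n) auto
    then show ?thesis
      using ray_cut_off[of m] N[of m] by blast
  qed
  obtain k where k: "k \<in> I" "k > N"
    using I unfolding infinite_nat_iff_unbounded by blast
  obtain m z where m: "m \<ge> k" and z: "z \<in> U" "z \<in> D m v - D (Suc m) v"
    using U[of k] by blast
  have z_ray: "conn G (- X) z (ray (Suc m))"
    using conn_cut_off[OF z(2)] by (rule conn_mono) (use N m k in simp)
  have "conn G (- X) (ray k) (ray n)" if "n \<ge> k" for n
    using that
  proof (induction n rule: dec_induct)
    case base
    then show ?case
      using ray_X[OF k(2)] ray_in_verts by (simp add: conn_refl)
  next
    case (step n)
    have "conn G (- X) (ray n) (ray (Suc n))"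
      using step.hyps k ray_Suc(3)[of n] ray_X ray_in_verts by (intro conn_edge) auto
    with step.IH show ?case
      by (rule conn_trans)
  qed
  from conn_sym[OF this[OF le_SucI[OF m]]] have "conn G (- X) z (ray k)"
    by (rule conn_trans[OF z_ray])
  then show ?thesis
    using k(1) z(1) by blast
qed

end

end

section \<open>Searches that chase countably many targets\<close>

text \<open>
  Each chain \<open>c\<close> announces a countable set \<open>aims c\<close> of targets, which stay on the agenda for
  all extensions of \<open>c\<close>. The number of a target is its priority, and always the most urgent
  target in the current component is approached on a shortest path.
\<close>

locale targeted_search =
  fixes G :: "'a ugraph" and r :: 'a and aims :: "'a list \<Rightarrow> 'a set"
  assumes graph: "graph G" and connected: "connected_graph G" and root: "r \<in> verts G"
    and countable_aims: "\<And>c. countable (aims c)"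
begin

text \<open>All announcements are merged into one order of priorities: \<open>m\<close> encodes a
  pair \<open>(j, i)\<close>, the \<open>i\<close>-th target of the chain of stage \<open>j\<close>,
  which is the prefix of length \<open>Suc j\<close>.\<close>

definition task :: "'a list \<Rightarrow> nat \<Rightarrow> 'a" where
  "task c m = (case prod_decode m of (j, i) \<Rightarrow> from_nat_into (aims (take (Suc j) c)) i)"

definition target :: "'a list \<Rightarrow> 'a set \<Rightarrow> 'a" where
  "target c S = (if \<exists>m. task c m \<in> S then task c (LEAST m. task c m \<in> S) else SOME z. z \<in> S)"

definition approach :: "'a list \<Rightarrow> 'a set \<Rightarrow> 'a list \<Rightarrow> bool" where
  "approach c S p \<longleftrightarrow> is_path G p \<and> hd p = last c \<and> last p = target c S \<and> set (tl p) \<subseteq> S"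

definition shortest :: "'a list \<Rightarrow> 'a set \<Rightarrow> 'a list" where
  "shortest c S = arg_min length (approach c S)"

definition nxt :: "'a list \<Rightarrow> 'a set \<Rightarrow> 'a" where
  "nxt c S = hd (tl (shortest c S))"

lemma target_in: "S \<noteq> {} \<Longrightarrow> target c S \<in> S"
  unfolding target_def by (auto intro: LeastI some_in_eq[THEN iffD2])

lemma shortest:
  assumes "approach c S p"
  shows "approach c S (shortest c S)" "length (shortest c S) \<le> length p"
  using arg_min_nat_lemma[of "approach c S" p length] assms by (auto simp: shortest_def)

lemma ex_approach:
  assumes "v \<in> verts G - set c" "last c \<in> verts G" "c \<noteq> []"
    and "w \<in> component G (- set c) v" "{last c, w} \<in> edges G"
  shows "\<exists>p. approach c (component G (- set c) v) p"
proof -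
  let ?S = "component G (- set c) v"
  have "conn G ?S w (target c ?S)"
    using assms(4) target_in[of ?S c] by (intro conn_in_component) auto
  then obtain q where q: "is_path G q" "hd q = w" "last q = target c ?S" "set q \<subseteq> ?S"
    by (rule connE)
  have "last c \<notin> ?S" "q \<noteq> []"
    using assms(3) component_subset[of G "- set c" v] q(1) by (auto simp: is_path_iff)
  then show ?thesis
    using assms q unfolding approach_def
    by (intro exI[of _ "last c # q"]) (auto simp: is_path_Cons)
qed

lemma shortest_split:
  assumes "approach c S p" "S \<noteq> {}" "last c \<notin> S"
  shows "\<exists>q. shortest c S = last c # nxt c S # q"
proof -
  have s: "approach c S (shortest c S)"
    using assms(1) by (rule shortest)
  have "target c S \<noteq> last c"
    using target_in[OF assms(2), of c] assms(3) by auto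
  then show ?thesis
    using s unfolding nxt_def approach_def is_path_iff
    by (cases "shortest c S"; cases "tl (shortest c S)") auto
qed

sublocale search G r nxt
proof
  show "graph G" "connected_graph G" "r \<in> verts G"
    by (rule graph connected root)+
  fix c v
  let ?S = "component G (- set c) v"
  assume c: "c \<noteq> []" "v \<in> verts G - set c" "last c \<in> verts G"
    and "\<exists>w\<in>?S. {last c, w} \<in> edges G"
  then obtain p where p: "approach c ?S p"
    using ex_approach by blast
  have "?S \<noteq> {}" "last c \<notin> ?S"
    using c component_refl[of v G] component_subset[of G "- set c" v] by auto
  then obtain q where "shortest c ?S = last c # nxt c ?S # q"
    using shortest_split[OF p] by blast
  moreover have "approach c ?S (shortest c ?S)"
    using p by (rule shortest)
  ultimately show "nxt c ?S \<in> ?S \<and> {last c, nxt c ?S} \<in> edges G"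
    by (auto simp: approach_def is_path_Cons)
qed

section \<open>Targets leave the component of a missed vertex\<close>

context
  fixes v :: 'a
  assumes v: "v \<in> verts G" "v \<notin> W"
begin

text \<open>The search moves one vertex along the shortest approach. What follows that vertex avoids
  the new chain and ends at \<open>z\<close>, hence lies in the new component, so a shorter approach
  remains.\<close>

lemma approach_Suc:
  assumes "z \<in> D (Suc n) v" "target (chain n v) (D n v) = z" "target (chain (Suc n) v) (D (Suc n) v) = z"
  shows "length (shortest (chain (Suc n) v) (D (Suc n) v)) < length (shortest (chain n v) (D n v))"
proof -
  let ?s = "ray v (Suc n)" and ?c = "chain n v" and ?S = "D n v"
  note nc = not_in_chain[OF v, of n]
  have last: "last ?c \<in> verts G" "last ?c \<notin> ?S"
    using ray_in_verts[OF v, of n] component_subset[of G "- set ?c" v] last_in_set[of ?c]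
    by (auto simp: ray_def[OF v])
  obtain p where p: "approach ?c ?S p"
    using ex_approach[of v ?c] chain_attached[OF v(1) nc] v(1) nc last(1) chain_nonempty by blast
  have "?S \<noteq> {}"
    using v_in_D[OF v] by blast
  then obtain q where q: "shortest ?c ?S = last ?c # ?s # q"
    using shortest_split[OF p] last(2) ray_Suc(1)[OF v, of n] by auto
  have "approach ?c ?S (last ?c # ?s # q)"
    using shortest(1)[OF p] q by simp
  then have sq: "is_path G (?s # q)" "last (?s # q) = z" "set (?s # q) \<subseteq> ?S"
    using assms(2) by (auto simp: approach_def is_path_Cons)
  have "set q \<subseteq> D (Suc n) v"
  proof (cases "q = []")
    case False
    have "set q \<subseteq> - set (chain (Suc n) v)"
      using sq(1,3) component_subset[of G "- set ?c" v] unfolding chain_Suc[OF v]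
      by (auto simp: is_path_Cons)
    moreover have "is_path G q" "last q = z" "z \<in> set q"
      using sq False by (auto simp: is_path_Cons)
    ultimately show ?thesis
      using path_in_component assms(1) by metis
  qed simp
  then have "approach (chain (Suc n) v) (D (Suc n) v) (?s # q)"
    using sq assms(3) unfolding approach_def by (simp add: ray_def[OF v] del: chain.simps)
  then show ?thesis
    using shortest(2) q by fastforce
qed

lemma target_not_constant:
  assumes "\<And>n. n \<ge> N \<Longrightarrow> z \<in> D n v" "\<And>n. n \<ge> N \<Longrightarrow> target (chain n v) (D n v) = z"
  shows False
proof -
  define l where "l n = length (shortest (chain n v) (D n v))" for n
  have decr: "l (Suc n) < l n" if "n \<ge> N" for n
    unfolding l_def using that by (intro approach_Suc[of z] assms) auto
  have "l (N + k) + k \<le> l N" for k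
  proof (induction k)
    case (Suc k)
    then show ?case
      using decr[of "N + k"] by simp
  qed simp
  from this[of "Suc (l N)"] show False
    by simp
qed

text \<open>Induction on the priority: once all more urgent targets have left the component for
  good, a target that stayed forever would be pursued at every later stage, against
  \<open>target_not_constant\<close>.\<close>

lemma aim_escapes:
  assumes "z \<in> aims (chain j v)"
  shows "\<exists>n. z \<notin> D n v"
proof -
  define t where "t m = (case prod_decode m of (j, i) \<Rightarrow> from_nat_into (aims (chain j v)) i)" for m
  \<comment> \<open>The \<open>m\<close>-th task belongs to a stage \<open>j\<close> that is at most
    \<open>m\<close>, so it is settled from stage \<open>m\<close> on.\<close>
  have task: "task (chain n v) m = t m" if "n \<ge> m" for n m
  proof -
    obtain j i where ji: "prod_decode m = (j, i)"
      by fastforce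
    then have "m = prod_encode (j, i)"
      by (metis prod_decode_inverse)
    then have "j \<le> n"
      using le_prod_encode_1[of j i] that by simp
    then show ?thesis
      using take_chain[OF not_in_chain[OF v]] ji by (simp add: task_def t_def)
  qed
  have "\<exists>n. t m \<notin> D n v" for m
  proof (induction m rule: less_induct)
    case (less m)
    have "\<forall>k\<in>{..<m}. \<forall>\<^sub>F n in sequentially. t k \<notin> D n v"
    proof
      fix k
      assume "k \<in> {..<m}"
      then obtain n where "t k \<notin> D n v"
        using less by blast
      then show "\<forall>\<^sub>F n in sequentially. t k \<notin> D n v"
        unfolding eventually_sequentially using D_antimono by (intro exI[of _ n]) blast
    qed
    then have "\<forall>\<^sub>F n in sequentially. \<forall>k\<in>{..<m}. t k \<notin> D n v"
      by (rule eventually_ball_finite[OF finite_lessThan])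
    then obtain N where N: "\<And>n k. n \<ge> N \<Longrightarrow> k < m \<Longrightarrow> t k \<notin> D n v"
      unfolding eventually_sequentially by auto
    show ?case
    proof (rule ccontr)
      assume "\<not> ?thesis"
      then have in_D: "t m \<in> D n v" for n
        by blast
      have "target (chain n v) (D n v) = t m" if n: "n \<ge> max N m" for n
      proof -
        have "(LEAST k. task (chain n v) k \<in> D n v) = m"
        proof (rule Least_equality)
          show "task (chain n v) m \<in> D n v"
            using task in_D n by simp
          fix k
          assume "task (chain n v) k \<in> D n v"
          then show "m \<le> k"
            using N[of n k] task[of k n] n by (cases "k < m") auto
        qed
        moreover have "task (chain n v) m = t m"
          using task n by simp
        moreover have "\<exists>k. task (chain n v) k \<in> D n v"
          using calculation in_D by metis
        ultimately show ?thesis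
          by (simp add: target_def)
      qed
      then show False
        using target_not_constant[of "max N m" "t m"] in_D by blast
    qed
  qed
  moreover have "t (prod_encode (j, to_nat_on (aims (chain j v)) z)) = z"
    using assms countable_aims by (simp add: t_def)
  ultimately show ?thesis
    by metis
qed

end

end

section \<open>The normal tree containing \<open>U\<close>\<close>

theorem theorem3:
  fixes G :: "'a ugraph" and U :: "'a set"
  assumes "graph G"
    and "connected_graph G"
    and "U \<subseteq> verts G"
    and "\<And>H. fat_TK_in G H \<Longrightarrow> \<exists>X. finite X \<and> separates G X H U"
  shows "\<exists>T r. normal_tree G T r \<and> U \<subseteq> verts T"
proof -
  \<comment> \<open>Requiring an inner vertex excludes single edges, so that independent paths are
    also edge-disjoint.\<close>
  define A where "A e = {p. is_path G p \<and> {hd p, last p} = e \<and> inner_verts p \<noteq> {}}" for e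
  define indep :: "'a list \<Rightarrow> 'a list \<Rightarrow> bool"
    where "indep p q \<longleftrightarrow> inner_verts p \<inter> inner_verts q = {}" for p q
  obtain M where M_A: "\<And>e. M e \<subseteq> A e" and M_indep: "\<And>e. pairwise indep (M e)"
    and M_max: "\<And>e p. p \<in> A e \<Longrightarrow> pairwise indep (insert p (M e)) \<Longrightarrow> p \<in> M e"
    using ex_maximal_pairwise[of "A _" indep] by metis
  \<comment> \<open>Dropping the last vertex of \<open>c\<close> restores the component from which
    it was chosen. For the search of some \<open>u\<close> in \<open>U\<close> that component
    contains \<open>u\<close>, so the choice does yield a vertex of \<open>U\<close>; if
    \<open>U\<close> misses it, the value is arbitrary.\<close>
  define aims where "aims c = insert (SOME z. z \<in> U \<inter> component G (- set (butlast c)) (last c))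
    (\<Union>x\<in>set c. \<Union>y\<in>set c. if countable (M {x, y}) then \<Union> (set ` M {x, y}) else {})" for c
  have countable_aims: "countable (aims c)" for c
  proof -
    have "countable (\<Union> (set ` M e))" if "countable (M e)" for e
      using that by (intro countable_UN) (auto simp: countable_finite)
    then show ?thesis
      unfolding aims_def by (intro countable_insert countable_UN) (simp_all add: countable_finite)
  qed
  obtain r where "r \<in> verts G"
    using assms(2) by (auto simp: connected_graph_def)
  then interpret targeted_search G r aims
    using assms(1,2) countable_aims by unfold_locales
  have "U \<subseteq> W"
  proof (rule ccontr)
    assume "\<not> U \<subseteq> W"
    then obtain u where u: "u \<in> U" "u \<in> verts G" "u \<notin> W"
      using assms(3) by blast
    define s where "s = ray u"
    define Dw where "Dw = component G (- range s) u"
    define I where "I = {n. \<exists>w\<in>Dw. {s n, w} \<in> edges G}"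
    have I: "infinite I"
      unfolding I_def Dw_def s_def by (rule infinite_ray_neighbours[OF u(2,3)])
    have inj_s: "inj s" and s_verts: "s n \<in> verts G" for n
      unfolding s_def by (rule inj_ray[OF u(2,3)], rule ray_in_verts[OF u(2,3)])
    have aims_Dw: "z \<notin> Dw" if "z \<in> aims (chain n u)" for z n
      using aim_escapes[OF u(2,3) that] D_omega_subset[OF u(2,3)] unfolding Dw_def s_def by blast
    \<comment> \<open>The vertex \<open>z\<close> of \<open>U\<close> announced at stage
      \<open>Suc n\<close> lies in \<open>D n u\<close> but, being a target, not in all later
      components; so it is cut off at some stage.\<close>
    have U_cut_off: "\<exists>m\<ge>n. U \<inter> (D m u - D (Suc m) u) \<noteq> {}" for n
    proof -
      define z where "z = (SOME z. z \<in> U \<inter> component G (- set (butlast (chain (Suc n) u))) (last (chain (Suc n) u)))"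
      have "component G (- set (butlast (chain (Suc n) u))) (last (chain (Suc n) u)) = D n u"
        using component_eq[OF ray_Suc(2)[OF u(2,3), of n]] unfolding chain_Suc[OF u(2,3)] by simp
      then have "z \<in> U \<inter> D n u"
        using someI[of "\<lambda>z. z \<in> U \<inter> D n u" u] u(1) v_in_D[OF u(2,3), of n] by (simp add: z_def)
      moreover have "z \<in> aims (chain (Suc n) u)"
        unfolding z_def aims_def by blast
      then obtain l where l: "z \<notin> D l u"
        using aim_escapes[OF u(2,3)] by blast
      have "\<exists>m\<ge>n. z \<in> D m u - D (Suc m) u"
      proof (rule ccontr)
        assume *: "\<not> ?thesis"
        have "z \<in> D (n + k) u" for k
        proof (induction k)
          case 0
          then show ?case using calculation by simp
        next
          case (Suc k)
          then show ?case using * by (metis Diff_iff add_Suc_right le_add1)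
        qed
        then show False
          using l D_antimono[of l "n + l" u] by (meson le_add2 subsetD)
      qed
      ultimately show ?thesis
        by blast
    qed
    have uncountable_M: "uncountable (M {s i, s j})" if ij: "i \<in> I" "j \<in> I" "i \<noteq> j" for i j
    proof
      assume countable: "countable (M {s i, s j})"
      \<comment> \<open>Both ends are on the chain of stage \<open>max i j\<close>, so a countable
        family has all its vertices announced there, and no target survives into
        \<open>Dw\<close>.\<close>
      have M_Dw: "set p \<inter> Dw = {}" if "p \<in> M {s i, s j}" for p
      proof -
        have "s i \<in> set (chain (max i j) u)" "s j \<in> set (chain (max i j) u)"
          unfolding s_def set_chain[OF u(2,3)] by auto
        then have "set p \<subseteq> aims (chain (max i j) u)"
          using that countable unfolding aims_def by auto
        then show ?thesis
          using aims_Dw by blast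
      qed
      obtain x y where xy: "x \<in> Dw" "{s i, x} \<in> edges G" "y \<in> Dw" "{s j, y} \<in> edges G"
        using ij(1,2) unfolding I_def by blast
      have "conn G Dw x y"
        using xy unfolding Dw_def by (intro conn_in_component)
      then obtain q where q: "is_path G q" "hd q = x" "last q = y" "set q \<subseteq> Dw"
        by (rule connE)
      define p where "p = s i # q @ [s j]"
      have "q \<noteq> []"
        using q(1) by (simp add: is_path_iff)
      have "range s \<inter> Dw = {}"
        using component_subset[of G "- range s" u] by (auto simp: Dw_def)
      then have "is_path G p"
        using q xy s_verts inj_s ij(3) \<open>q \<noteq> []\<close> unfolding p_def is_path_iff
        by (auto simp: successively_append_iff successively_Cons insert_commute inj_eq)
      moreover have inner: "inner_verts p = set q"
        by (simp add: p_def inner_verts_def butlast_append)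
      ultimately have "p \<in> A {s i, s j}"
        using \<open>q \<noteq> []\<close> by (simp add: A_def p_def)
      moreover have "pairwise indep (insert p (M {s i, s j}))"
        using M_indep M_Dw q(4) inner inner_verts_subset
        unfolding pairwise_insert indep_def by fast
      ultimately have "p \<in> M {s i, s j}"
        by (rule M_max)
      then show False
        using M_Dw[of p] q(4) \<open>q \<noteq> []\<close> by (cases q) (auto simp: p_def)
    qed
    \<comment> \<open>Only ray vertices with a neighbour in \<open>Dw\<close> serve as branch
      vertices; the increasing enumeration of the infinite set \<open>I\<close> numbers them by all
      of \<open>nat\<close>.\<close>
    define b where "b i = s (enumerate I i)" for i
    have b: "inj b" "range b \<subseteq> verts G" "range b = s ` I"
    proof -
      show "inj b"
        using inj_compose[OF inj_s strict_mono_imp_inj_on[OF strict_mono_enumerate[OF I]]]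
        by (simp add: b_def[abs_def] comp_def)
      show "range b \<subseteq> verts G"
        using s_verts by (auto simp: b_def)
      show "range b = s ` I"
        by (subst range_enumerate[OF I, symmetric]) (simp only: b_def[abs_def] image_image)
    qed
    obtain H where H: "fat_TK_in G H" "range b \<subseteq> verts H"
    proof (rule fat_TK_if_uncountable_families[OF assms(1) b(1,2), of "\<lambda>e. M (b ` e)"])
      show "uncountable (M (b ` {i, j}))" if "i \<noteq> j" for i j
        using uncountable_M[of "enumerate I i" "enumerate I j"] that enumerate_in_set[OF I]
          strict_mono_eq[OF strict_mono_enumerate[OF I]] by (simp add: b_def)
      show "is_path G p \<and> {hd p, last p} = b ` e \<and> inner_verts p \<noteq> {}" if "p \<in> M (b ` e)" for e p
        using that M_A[of "b ` e"] by (auto simp: A_def)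
      show "inner_verts p \<inter> inner_verts q = {}"
        if "p \<in> M (b ` e)" "q \<in> M (b ` e)" "p \<noteq> q" for e p q
        using pairwiseD[OF M_indep that] by (simp add: indep_def)
    qed blast
    obtain X where X: "finite X" "separates G X H U"
      using assms(4)[OF H(1)] by blast
    obtain k z where "k \<in> I" "z \<in> U" "conn G (- X) z (s k)"
      using not_separated[OF u(2,3) X(1) I U_cut_off] unfolding s_def by blast
    moreover from this have "s k \<in> verts H"
      using H(2) b(3) by blast
    ultimately show False
      using X(2) unfolding separates_def by (auto elim!: connE)
  qed
  then show ?thesis
    using normal_tree_T by (intro exI[of _ T] exI[of _ r]) simp
qed

end
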